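(* Let $q-1=\ell s$ with $\ell,s$ positive integers, let $r_0,\ldots,r_{\ell-1}$ be positive integers, let $g_0(x),\ldots,g_{\ell-1}(x)$ be any $\ell$ polynomials over $\mathbb{F}_q$, and define $P:\mathbb{F}_q\to\mathbb{F}_q$ by $P(0)=0$ and $P(x)=x^{r_i}g_i(x^s)^\ell$ if $x\in C_i$, for $0\le i\le\ell-1$. Then $P(x)$ is a permutation polynomial of $\mathbb{F}_q$ if and only if $\{r_ii\mid i=0,\ldots,\ell-1\}$ is a complete set of residues modulo $\ell$, and $\gcd(r_i,s)=1$ and $g_i(\zeta^i)\neq 0$ for all $0\le i\le\ell-1$.
   Context: $q$ is a prime power, $\gamma$ a fixed primitive element (generator of $\mathbb{F}_q^*$). $C_0=\{\gamma^{\ell j}: 0\le j\le s-1\}$ and $C_i=\gamma^iC_0$ for $0\le i\le\ell-1$ are the cyclotomic cosets. $\zeta=\gamma^s$ is a primitive $\ell$-th root of unity. A map (or polynomial) is a permutation polynomial (PP) of $\mathbb{F}_q$ if it induces a bijection of $\mathbb{F}_q$. *)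

theory Defs
  imports
    "HOL-Library.Cardinality"
    "HOL-Computational_Algebra.Computational_Algebra"
    "HOL-Number_Theory.Number_Theory"
begin

definition primitive_element :: "'a::field \<Rightarrow> bool" where
  "primitive_element \<gamma> \<longleftrightarrow> range (\<lambda>n::nat. \<gamma> ^ n) = UNIV - {0}"

definition cyclotomic_coset :: "'a::field \<Rightarrow> nat \<Rightarrow> nat \<Rightarrow> nat \<Rightarrow> 'a set" where
  "cyclotomic_coset \<gamma> l s i = (\<lambda>c. \<gamma> ^ i * c) ` {\<gamma> ^ (l * j) |j. j < s}"

text \<open>A set meeting every residue class in exactly one element. If two products
  \<open>r\<^sub>i i\<close> coincide as integers, the set \<open>{r\<^sub>i i | i < l}\<close> has fewer than \<open>l\<close> elements
  and is not complete, so reading it as a set or as a family makes no difference.\<close>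

definition complete_residue_set :: "int \<Rightarrow> int set \<Rightarrow> bool" where
  "complete_residue_set m S \<longleftrightarrow> (\<forall>a::int. \<exists>!b. b \<in> S \<and> [b = a] (mod m))"

end

(* Every nonzero element is a power of gamma, and gamma ^ m = gamma ^ n iff m and n agree modulo
   l * s. On C_i the value g_i (x ^ s) is the constant g_i (zeta ^ i); if it equals gamma ^ k, then P
   acts on exponents n congruent to i modulo l as n |-> r_i * n + l * k. Reduced modulo l this sends
   i to r_i * i, so the l-th power does not affect which coset C_i is mapped into; on the exponents
   i + l * t of C_i it is injective modulo l * s iff r_i is coprime to s. *)
theory Submission
  imports Defs
begin

lemma finite_field_power_card_minus_1:
  fixes x :: "'a::finite_field"
  assumes "x \<noteq> 0"
  shows "x ^ (CARD('a) - 1) = 1"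
proof -
  have "x ^ (CARD('a) - 1) * x = x ^ CARD('a)"
    by (intro power_minus_mult) simp
  also have "\<dots> = x"
    by (rule finite_field_power_card_eq_same)
  finally show ?thesis
    using assms by simp
qed

text \<open>Since \<open>\<gamma> ^ N = 1\<close> for \<open>N = CARD('a) - 1\<close>, exponents
  matter only modulo \<open>N\<close>. The \<open>N\<close> exponents below \<open>N\<close>
  therefore already produce all \<open>N\<close> nonzero elements, so by counting their powers are
  pairwise distinct.\<close>

lemma primitive_element_power_eq_iff:
  fixes \<gamma> :: "'a::finite_field"
  assumes "primitive_element \<gamma>"
  shows "\<gamma> ^ m = \<gamma> ^ n \<longleftrightarrow> [m = n] (mod CARD('a) - 1)"
proof -
  define N where "N = CARD('a) - 1"
  have rng: "range (\<lambda>n::nat. \<gamma> ^ n) = UNIV - {0}"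
    using assms by (simp add: primitive_element_def)
  then have "\<gamma> ^ 1 \<in> UNIV - {0}"
    by blast
  then have "\<gamma> ^ N = 1"
    unfolding N_def by (intro finite_field_power_card_minus_1) simp
  then have red: "\<gamma> ^ (k mod N) = \<gamma> ^ k" for k
    by (metis mult_1 power_add power_mult power_one mult_div_mod_eq)
  have card: "card (UNIV - {0 :: 'a}) = N"
    by (simp add: N_def card_Diff_subset)
  \<comment> \<open>The distinct elements 0 and 1 give \<open>N > 0\<close>, so that residues modulo
    \<open>N\<close> really lie in \<open>{..<N}\<close>.\<close>
  have "card {0 :: 'a, 1} \<le> CARD('a)"
    by (intro card_mono) auto
  then have "N > 0"
    by (simp add: N_def)
  then have "(\<lambda>n. \<gamma> ^ n) ` {..<N} = range (\<lambda>n. \<gamma> ^ n)"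
    using red by (force simp: image_iff intro: bexI[of _ "_ mod N"])
  then have "inj_on (\<lambda>n. \<gamma> ^ n) {..<N}"
    using card rng by (intro eq_card_imp_inj_on) auto
  then have "\<gamma> ^ (m mod N) = \<gamma> ^ (n mod N) \<longleftrightarrow> m mod N = n mod N"
    using \<open>N > 0\<close> by (intro inj_on_eq_iff) auto
  then show ?thesis
    by (simp add: red cong_def N_def[symmetric] del: One_nat_def)
qed

text \<open>Taking residues turns \<open>f\<close> into a self-map of the finite set
  \<open>{..<l}\<close>, for which injectivity and surjectivity are equivalent. This replaces the
  condition on a set of integers by one on indices.\<close>

lemma complete_residue_set_iff_inj_on:
  fixes f :: "nat \<Rightarrow> nat"
  assumes "l > 0"
  shows "complete_residue_set (int l) {int (f i) |i. i < l} \<longleftrightarrow>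
    inj_on (\<lambda>i. f i mod l) {..<l}"
proof
  assume inj: "inj_on (\<lambda>i. f i mod l) {..<l}"
  then have img: "(\<lambda>i. f i mod l) ` {..<l} = {..<l}"
    using assms by (intro endo_inj_surj) auto
  show "complete_residue_set (int l) {int (f i) |i. i < l}"
    unfolding complete_residue_set_def
  proof (intro allI ex_ex1I)
    fix a :: int
    have "nat (a mod int l) \<in> (\<lambda>i. f i mod l) ` {..<l}"
      unfolding img using assms by (simp add: nat_less_iff)
    then obtain i where i: "i < l" "nat (a mod int l) = f i mod l"
      by auto
    then have "int (nat (a mod int l)) = int (f i) mod int l"
      by (simp add: zmod_int)
    then have "a mod int l = int (f i) mod int l"
      using assms by simp
    then show "\<exists>b. b \<in> {int (f i) |i. i < l} \<and> [b = a] (mod int l)"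
      using i(1) by (auto simp: cong_def)
  next
    fix a b c :: int
    assume "b \<in> {int (f i) |i. i < l} \<and> [b = a] (mod int l)"
      and "c \<in> {int (f i) |i. i < l} \<and> [c = a] (mod int l)"
    then obtain i j where ij: "i < l" "j < l" "b = int (f i)" "c = int (f j)"
      and "[b = c] (mod int l)"
      by (auto simp: cong_def)
    then have "f i mod l = f j mod l"
      by (simp add: cong_int_iff cong_def[symmetric])
    then have "i = j"
      using inj ij by (auto dest: inj_onD)
    then show "b = c"
      using ij by simp
  qed
next
  assume compl: "complete_residue_set (int l) {int (f i) |i. i < l}"
  \<comment> \<open>Uniqueness of representatives would only give \<open>f i = f j\<close>, not
    \<open>i = j\<close>. Existence gives surjectivity instead, and counting then separates the
    indices.\<close>
  have "{..<l} \<subseteq> (\<lambda>i. f i mod l) ` {..<l}"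
  proof
    fix a assume "a \<in> {..<l}"
    moreover obtain i where "i < l" "[int (f i) = int a] (mod int l)"
      using compl unfolding complete_residue_set_def by blast
    ultimately have "i < l" "f i mod l = a"
      unfolding cong_int_iff by (auto simp: cong_def)
    then show "a \<in> (\<lambda>i. f i mod l) ` {..<l}"
      by blast
  qed
  moreover have "(\<lambda>i. f i mod l) ` {..<l} \<subseteq> {..<l}"
    using assms by auto
  ultimately show "inj_on (\<lambda>i. f i mod l) {..<l}"
    by (intro eq_card_imp_inj_on) auto
qed

theorem corollary3p3:
  fixes \<gamma> \<zeta> :: "'a::finite_field"
    and l s :: nat
    and r :: "nat \<Rightarrow> nat"
    and g :: "nat \<Rightarrow> 'a poly"
    and P :: "'a \<Rightarrow> 'a"
  assumes "primitive_element \<gamma>"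
    and "l > 0" and "s > 0"
    and "CARD('a) - 1 = l * s"
    and "\<zeta> = \<gamma> ^ s"
    and "\<And>i. i < l \<Longrightarrow> r i > 0"
    and "P 0 = 0"
    and "\<And>i x. i < l \<Longrightarrow> x \<in> cyclotomic_coset \<gamma> l s i \<Longrightarrow>
           P x = x ^ r i * poly (g i) (x ^ s) ^ l"
  shows "bij P \<longleftrightarrow>
    complete_residue_set (int l) {int (r i * i) |i. i < l} \<and>
    (\<forall>i<l. gcd (r i) s = 1 \<and> poly (g i) (\<zeta> ^ i) \<noteq> 0)"
proof -
  define a where "a i = poly (g i) (\<zeta> ^ i)" for i
  have rng: "range (\<lambda>n::nat. \<gamma> ^ n) = UNIV - {0}"
    using assms(1) by (simp add: primitive_element_def)
  have pow_eq: "\<gamma> ^ m = \<gamma> ^ n \<longleftrightarrow> [m = n] (mod l * s)" for m n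
    using primitive_element_power_eq_iff[OF assms(1)] assms(4) by simp
  have pow_nz: "\<gamma> ^ n \<noteq> 0" for n
    using rng by blast
  have pow_ls: "\<gamma> ^ (l * s * n) = 1" for n
    using pow_eq[of "l * s * n" 0] by (simp add: cong_def)
  have ex_pow: "\<exists>n. x = \<gamma> ^ n" if "x \<noteq> 0" for x
    using rng that by blast
  have P_pow: "P (\<gamma> ^ n) = \<gamma> ^ (n * r (n mod l)) * a (n mod l) ^ l" for n
  proof -
    define i j where "i = n mod l" and "j = n div l"
    have i: "i < l" and n: "n = i + l * j"
      using assms(2) by (auto simp: i_def j_def)
    \<comment> \<open>The coset lists only exponents with \<open>j < s\<close>; reducing
      \<open>j\<close> modulo \<open>s\<close> changes the exponent by a multiple of
      \<open>l * s\<close>.\<close>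
    have "[i + l * j = i + l * (j mod s)] (mod l * s)"
      unfolding cong_def mult_mod_right by (rule mod_add_right_eq[symmetric])
    then have "\<gamma> ^ n = \<gamma> ^ i * \<gamma> ^ (l * (j mod s))"
      by (simp add: n pow_eq flip: power_add)
    moreover have "j mod s < s"
      using assms(3) by simp
    ultimately have "\<gamma> ^ n \<in> cyclotomic_coset \<gamma> l s i"
      unfolding cyclotomic_coset_def by blast
    moreover have "(\<gamma> ^ n) ^ s = \<gamma> ^ (s * i) * \<gamma> ^ (l * s * j)"
      by (simp add: n algebra_simps flip: power_add power_mult)
    then have "(\<gamma> ^ n) ^ s = \<zeta> ^ i"
      by (simp only: pow_ls assms(5) power_mult[of _ s i] mult_1_right)
    ultimately show ?thesis
      using assms(8)[OF i] by (simp add: a_def power_mult flip: i_def)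
  qed
  \<comment> \<open>The exponent \<open>k\<close> is chosen before \<open>n\<close>: one
    \<open>k\<close> serves the whole coset, which lets two points of it be compared.\<close>
  have P_exp: "\<exists>k. \<forall>n. n mod l = i \<longrightarrow> P (\<gamma> ^ n) = \<gamma> ^ (n * r i + l * k)" if nz: "a i \<noteq> 0" for i
  proof -
    obtain k where "a i = \<gamma> ^ k"
      using ex_pow[OF nz] by blast
    then show ?thesis
      by (intro exI[of _ k]) (auto simp: P_pow power_add mult.commute simp flip: power_mult)
  qed
  have mod_l: "[n * r i + l * k = r i * i] (mod l)" if "n mod l = i" for n i k
  proof -
    have "[r i * n = r i * i] (mod l)"
      by (intro cong_mult cong_refl) (simp add: that[symmetric] cong_def)
    then show ?thesis
      by (simp add: cong_def mult.commute)
  qed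
  have "bij P \<longleftrightarrow> inj_on (\<lambda>i. r i * i mod l) {..<l} \<and> (\<forall>i<l. gcd (r i) s = 1 \<and> a i \<noteq> 0)"
  proof (intro iffI conjI allI impI)
    assume "bij P"
    then have inj: "P x = P y \<Longrightarrow> x = y" for x y
      by (auto simp: bij_def dest: injD)
    show nz: "a i \<noteq> 0" if "i < l" for i
    proof
      assume "a i = 0"
      then have "P (\<gamma> ^ i) = P 0"
        using that assms(2,7) by (simp add: P_pow)
      then show False
        using inj pow_nz by blast
    qed
    show "gcd (r i) s = 1" if i: "i < l" for i
    proof -
      obtain k where k: "P (\<gamma> ^ n) = \<gamma> ^ (n * r i + l * k)" if "n mod l = i" for n
        using P_exp[OF nz[OF i]] by blast
      \<comment> \<open>With \<open>s = d * t\<close>, moving the exponent \<open>i\<close> by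
        \<open>l * t\<close> moves the image exponent by \<open>l * t * r i = l * s * u\<close>,
        which is invisible. Injectivity forces \<open>s dvd t\<close>, hence
        \<open>d = 1\<close>.\<close>
      define d where "d = gcd (r i) s"
      obtain u t where u: "r i = d * u" and t: "s = d * t"
        unfolding d_def by (meson dvdE gcd_dvd1 gcd_dvd2)
      have "(i + l * t) * r i + l * k = i * r i + l * k + l * s * u"
        by (simp add: u t algebra_simps)
      then have "P (\<gamma> ^ (i + l * t)) = \<gamma> ^ (i * r i + l * k) * \<gamma> ^ (l * s * u)"
        using i by (simp add: k add_ac flip: power_add)
      then have "P (\<gamma> ^ (i + l * t)) = P (\<gamma> ^ i)"
        using i by (simp add: k pow_ls)
      then have "[i + l * t = i] (mod l * s)"
        using inj pow_eq by blast
      then have "s dvd t"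
        using assms(2) by (simp add: cong_add_lcancel_0_nat cong_0_iff)
      then show ?thesis
        using t assms(3) by (fold d_def) (auto simp: mult_le_cancel2 dest!: dvd_imp_le)
    qed
    \<comment> \<open>Surjectivity of \<open>P\<close> enters here: a preimage of
      \<open>\<gamma> ^ b\<close> lies in some coset \<open>i\<close>, and comparing exponents
      modulo \<open>l\<close> gives \<open>r i * i mod l = b\<close>.\<close>
    have "{..<l} \<subseteq> (\<lambda>i. r i * i mod l) ` {..<l}"
    proof
      fix b assume b: "b \<in> {..<l}"
      obtain x where x: "P x = \<gamma> ^ b"
        using \<open>bij P\<close> by (metis bij_pointE)
      then have "x \<noteq> 0"
        using assms(7) pow_nz by metis
      then obtain n where n: "x = \<gamma> ^ n"
        using ex_pow by blast
      define i where "i = n mod l"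
      have i: "i < l"
        using assms(2) by (simp add: i_def)
      obtain k where "P (\<gamma> ^ n) = \<gamma> ^ (n * r i + l * k)"
        using P_exp[OF nz[OF i]] i_def by blast
      then have "[n * r i + l * k = b] (mod l)"
        using x n pow_eq cong_modulus_mult_nat by metis
      then have "r i * i mod l = b"
        using mod_l[of n i k] b by (simp add: i_def cong_def)
      then show "b \<in> (\<lambda>i. r i * i mod l) ` {..<l}"
        using i by blast
    qed
    moreover have "(\<lambda>i. r i * i mod l) ` {..<l} \<subseteq> {..<l}"
      using assms(2) by auto
    ultimately show "inj_on (\<lambda>i. r i * i mod l) {..<l}"
      by (intro eq_card_imp_inj_on) auto
  next
    assume "inj_on (\<lambda>i. r i * i mod l) {..<l} \<and> (\<forall>i<l. gcd (r i) s = 1 \<and> a i \<noteq> 0)"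
    then have inj: "inj_on (\<lambda>i. r i * i mod l) {..<l}"
      and cop: "i < l \<Longrightarrow> coprime (r i) s" and nz: "i < l \<Longrightarrow> a i \<noteq> 0" for i
      unfolding coprime_iff_gcd_eq_1 by blast+
    have P_nz: "P (\<gamma> ^ n) \<noteq> 0" for n
      using assms(2) pow_nz[of 1] by (simp add: P_pow nz)
    \<comment> \<open>The order \<open>m \<le> n\<close> allows the difference of exponents to be
      written as a natural number \<open>l * t\<close>; the other case follows by symmetry.\<close>
    have P_inj: "\<gamma> ^ m = \<gamma> ^ n" if eq: "P (\<gamma> ^ m) = P (\<gamma> ^ n)" and le: "m \<le> n" for m n
    proof -
      define i j where "i = m mod l" and "j = n mod l"
      have i: "i < l" and j: "j < l"
        using assms(2) by (auto simp: i_def j_def)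
      obtain k k' where k: "P (\<gamma> ^ m) = \<gamma> ^ (m * r i + l * k)"
        and k': "P (\<gamma> ^ n) = \<gamma> ^ (n * r j + l * k')"
        using P_exp[OF nz[OF i]] P_exp[OF nz[OF j]] i_def j_def by blast
      have "[m * r i + l * k = n * r j + l * k'] (mod l)"
        using eq k k' pow_eq cong_modulus_mult_nat by metis
      then have "r i * i mod l = r j * j mod l"
        using mod_l[of m i k] mod_l[of n j k'] by (simp add: i_def j_def cong_def)
      then have ij: "i = j"
        using inj i j by (auto dest: inj_onD)
      obtain t where t: "n = m + l * t"
        using ij le by (metis i_def j_def mod_eq_nat1E)
      \<comment> \<open>Both points are now known to lie in the same coset, so the common nonzero
        factor \<open>a i ^ l\<close> cancels.\<close>
      have "\<gamma> ^ (m * r i) = \<gamma> ^ (n * r i)"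
        using eq nz[OF i] ij by (simp add: P_pow flip: i_def j_def)
      then have "[m * r i = m * r i + l * t * r i] (mod l * s)"
        by (simp add: pow_eq t algebra_simps)
      then have "l * s dvd l * t * r i"
        by (metis cong_0_iff cong_add_lcancel_0_nat cong_sym)
      then have "s dvd t * r i"
        using assms(2) by (simp add: mult.assoc)
      then have "s dvd t"
        using cop[OF i] by (simp add: coprime_dvd_mult_left_iff coprime_commute)
      then have "[m + l * t = m] (mod l * s)"
        by (simp add: cong_add_lcancel_0_nat cong_0_iff)
      then show ?thesis
        using pow_eq t by metis
    qed
    have "inj P"
    proof (rule injI)
      fix x y assume xy: "P x = P y"
      show "x = y"
      proof (cases "x = 0 \<or> y = 0")
        case True
        then show ?thesis
          using xy assms(7) ex_pow P_nz by metis
      next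
        case False
        then obtain m n where "x = \<gamma> ^ m" "y = \<gamma> ^ n"
          using ex_pow by blast
        then show ?thesis
          using xy P_inj[of m n] P_inj[of n m] by (metis nle_le)
      qed
    qed
    then show "bij P"
      by (simp add: bij_def finite_UNIV_inj_surj)
  qed
  then show ?thesis
    by (simp only: complete_residue_set_iff_inj_on[OF assms(2)] a_def)
qed

end
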